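(* Let $d\ge1$, $\kappa>0$, $\sigma\ge0$, and let $V:\mathbb{R}^d\to[0,\infty)$ satisfy the following assumptions: (i) $V\in C^2(\mathbb{R}^d)$ and there exist $0<\mu\le L<\infty$ such that $\mu\,\mathbb{I}\preccurlyeq D^2V(x)\preccurlyeq L\,\mathbb{I}$ for all $x\in\mathbb{R}^d$; (ii) if $\sigma>0$, then additionally $V\in C^3(\mathbb{R}^d)$ and $\sup_{x\in\mathbb{R}^d}|DV(x)|\,|D^3V(x)|<\infty$. Let $p(x):=\arg\min_{y\in\mathbb{R}^d}\left\{\frac{|x-y|^2}{2\kappa^2}+V(y)\right\}$, $\mathsf{L}[\rho]:=\frac12\int|x-p(x)|^2\,d\rho(x)$, and $x^\ast:=\arg\min V$. Then there exists a constant $C_1>0$, not depending on $\sigma$ or on the solution below, such that, if $\sigma<C_1$, every weak solution $t\mapsto\rho_t$ of the Fokker--Planck equation $$\partial_t\rho_t(x)=\operatorname{div}\big(\rho_t(x)(x-p(x))\big)+\frac{\sigma^2}{2}\Delta\left(\rho_t(x)|x-p(x)|^2\right)$$ with $\mathsf{L}[\rho_0]<\infty$ satisfies $$W_2(\rho_t,\delta_{x^\ast})\to0\quad\text{as }t\to\infty.$$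
   Context: $\mathbb{I}$ is the $d\times d$ identity matrix, $A\succcurlyeq B$ (equivalently $B\preccurlyeq A$) means that $A-B$ is positive semidefinite, and $|\cdot|$ denotes Euclidean (vector/matrix/tensor) norms. All integrals are over $\mathbb{R}^d$; $W_2$ is the Wasserstein-2 distance and $\delta_{x^\ast}$ the Dirac measure at $x^\ast$. The map $p$ is the proximal operator of $\kappa^2V$; $p$ and $x^\ast$ are well defined since $V$ is strongly convex. A weak solution of the Fokker--Planck equation is a continuous curve of probability measures $t\mapsto\rho_t$ on $\mathbb{R}^d$ such that for all $\phi\in C_c^\infty(\mathbb{R}^d)$ $$\frac{d}{dt}\int\phi(x)\,d\rho_t(x)=-\int\nabla\phi(x)\cdot(x-p(x))\,d\rho_t(x)+\frac{\sigma^2}{2}\int\Delta\phi(x)\,|x-p(x)|^2\,d\rho_t(x).$$ *)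

theory Defs
  imports "HOL-Probability.Probability"
begin

definition partial :: "'n \<Rightarrow> (real^'n \<Rightarrow> real) \<Rightarrow> real^'n \<Rightarrow> real" where
  "partial i f x = frechet_derivative f (at x) (axis i 1)"

text \<open>\<open>Ck k f\<close>, i.e. $f \in C^k(\mathbb{R}^d)$, says that all partial derivatives of \<open>f\<close> up to order \<open>k\<close>
  exist and are continuous.\<close>

primrec Ck :: "nat \<Rightarrow> (real^'n \<Rightarrow> real) \<Rightarrow> bool" where
  "Ck 0 f \<longleftrightarrow> continuous_on UNIV f"
| "Ck (Suc k) f \<longleftrightarrow> (\<forall>x. f differentiable (at x)) \<and> (\<forall>i. Ck k (partial i f))"

definition gradient :: "(real^'n \<Rightarrow> real) \<Rightarrow> real^'n \<Rightarrow> real^'n" where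
  "gradient f x = (\<chi> i. partial i f x)"

definition hessian :: "(real^'n \<Rightarrow> real) \<Rightarrow> real^'n \<Rightarrow> real^'n^'n" where
  "hessian f x = (\<chi> i j. partial i (partial j f) x)"

text \<open>The library norm on the nested vector type is the Euclidean norm of the tensor of all
  third partial derivatives.\<close>

definition third_derivative :: "(real^'n \<Rightarrow> real) \<Rightarrow> real^'n \<Rightarrow> real^'n^'n^'n" where
  "third_derivative f x = (\<chi> i j k. partial i (partial j (partial k f)) x)"

definition laplacian :: "(real^'n \<Rightarrow> real) \<Rightarrow> real^'n \<Rightarrow> real" where
  "laplacian f x = (\<Sum>i\<in>UNIV. partial i (partial i f) x)"

definition test_function :: "(real^'n \<Rightarrow> real) \<Rightarrow> bool" where
  "test_function \<phi> \<longleftrightarrow> (\<forall>k. Ck k \<phi>) \<and> compact (closure {x. \<phi> x \<noteq> 0})"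

definition pos_semidef :: "real^'n^'n \<Rightarrow> bool" where
  "pos_semidef A \<longleftrightarrow> transpose A = A \<and> (\<forall>v. 0 \<le> v \<bullet> (A *v v))"

definition loewner_le :: "real^'n^'n \<Rightarrow> real^'n^'n \<Rightarrow> bool"  (infix \<open>\<preceq>\<^sub>L\<close> 50) where
  "B \<preceq>\<^sub>L A \<longleftrightarrow> pos_semidef (A - B)"

definition prox :: "real \<Rightarrow> (real^'n \<Rightarrow> real) \<Rightarrow> real^'n \<Rightarrow> real^'n" where
  "prox \<kappa> V x = (ARG_MIN (\<lambda>y. (norm (x - y))\<^sup>2 / (2 * \<kappa>\<^sup>2) + V y) y. True)"

definition energy :: "(real^'n \<Rightarrow> real^'n) \<Rightarrow> (real^'n) measure \<Rightarrow> ennreal" where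
  "energy p \<rho> = (1 / 2) * (\<integral>\<^sup>+ x. ennreal ((norm (x - p x))\<^sup>2) \<partial>\<rho>)"

definition borel_prob :: "'a::topological_space measure \<Rightarrow> bool" where
  "borel_prob \<mu> \<longleftrightarrow> prob_space \<mu> \<and> sets \<mu> = sets borel"

text \<open>Continuity of a curve of measures on $[0,\infty)$ is understood in the narrow topology,
  i.e. in duality with bounded continuous functions.\<close>

definition narrowly_continuous :: "(real \<Rightarrow> 'a::topological_space measure) \<Rightarrow> bool" where
  "narrowly_continuous \<rho> \<longleftrightarrow>
     (\<forall>f :: 'a \<Rightarrow> real. continuous_on UNIV f \<and> bounded (range f) \<longrightarrow>
        continuous_on {0..} (\<lambda>t. \<integral>x. f x \<partial>\<rho> t))"

text \<open>Curves are indexed by all reals, but only their values at times $t \ge 0$ matter. The equation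
  is only required at $t > 0$; continuity up to $t = 0$ attaches the initial datum.\<close>

definition FP_weak_solution ::
    "real \<Rightarrow> (real^'n \<Rightarrow> real^'n) \<Rightarrow> (real \<Rightarrow> (real^'n) measure) \<Rightarrow> bool" where
  "FP_weak_solution \<sigma> p \<rho> \<longleftrightarrow>
     (\<forall>t\<ge>0. borel_prob (\<rho> t)) \<and> narrowly_continuous \<rho> \<and>
     (\<forall>\<phi>. test_function \<phi> \<longrightarrow>
       (\<forall>t>0. ((\<lambda>s. \<integral>x. \<phi> x \<partial>\<rho> s) has_real_derivative
          (- (\<integral>x. gradient \<phi> x \<bullet> (x - p x) \<partial>\<rho> t)
           + \<sigma>\<^sup>2 / 2 * (\<integral>x. laplacian \<phi> x * (norm (x - p x))\<^sup>2 \<partial>\<rho> t))) (at t)))"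

definition couplings :: "'a::topological_space measure \<Rightarrow> 'a measure \<Rightarrow> ('a \<times> 'a) measure set" where
  "couplings \<mu> \<nu> = {\<gamma>. prob_space \<gamma> \<and> sets \<gamma> = sets (borel \<Otimes>\<^sub>M borel) \<and>
                       distr \<gamma> borel fst = \<mu> \<and> distr \<gamma> borel snd = \<nu>}"

definition ennreal_sqrt :: "ennreal \<Rightarrow> ennreal" where
  "ennreal_sqrt a = (if a = \<infinity> then \<infinity> else ennreal (sqrt (enn2real a)))"

text \<open>The value is $\infty$ if no coupling has finite quadratic cost.\<close>

definition W2 :: "'a::metric_space measure \<Rightarrow> 'a measure \<Rightarrow> ennreal" where
  "W2 \<mu> \<nu> = ennreal_sqrt (INF \<gamma>\<in>couplings \<mu> \<nu>. \<integral>\<^sup>+ z. ennreal ((dist (fst z) (snd z))\<^sup>2) \<partial>\<gamma>)"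

end

theory Submission
  imports Defs
begin

text \<open>Write $z = x^\ast$, $b(x) = x - p(x)$ and $M(t) = \int |x - z|^2\,d\rho_t$. A coupling with a
  Dirac measure is a product, so it is enough that $M(t) \to 0$ (\<open>W2_dirac_le\<close>).

  Strong convexity makes the proximal map a contraction with factor
  $\theta = 1 / (1 + \kappa^2 \mu) < 1$ and fixed point $z$ (\<open>prox_contraction\<close>, \<open>prox_minimizer\<close>).
  Hence $(x - z) \cdot b(x) \ge (1 - \theta) |x - z|^2$ and $|b(x)| \le 2 |x - z|$, so that for
  $\phi(x) = |x - z|^2$ and $4 d \sigma^2 \le 1 - \theta$
  \[ - \nabla\phi \cdot b + \tfrac{\sigma^2}{2} \Delta\phi\, |b|^2
     = - 2 (x - z) \cdot b + d \sigma^2 |b|^2 \le - c\, \phi, \qquad c = 1 - \theta. \]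
  If $\phi$ were an admissible test function, $M' \le - c M$ would follow at once.

  The equation only speaks about compactly supported test functions. Since the $\rho_t$ are
  probability measures, it also holds for functions that are constant outside a compact set, and
  these can approximate $\phi$ from below by functions of the form $h_r(|x - z|^2)$ with $h_r$
  nondecreasing and concave. Concavity is what matters: the additional second order term then has
  the good sign, whatever the size of $|b|$. The explicit choice
  $h_r(s) = r\, \frac{e^2}{2} \big(g(\frac12) - g(\frac12 - \frac{s}{2r})\big)$ with
  $g(y) = e^{-1/y}$ works, because $g$ is smooth, vanishes for $y \le 0$ and is convex on
  $(-\infty, \frac12]$. The integral $F_r(t) = \int h_r(|x - z|^2)\,d\rho_t$ satisfies
  $F_r' \le - c (F_r - E_r)$, where $E_r(t)$ integrates the bounded continuous function
  $h_r(s) - s h_r'(s)$ and is therefore continuous in time (\<open>F_derivative\<close>). First this shows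
  that $F_r$ does not increase, so $M(t) \le M(0)$ for all $t$ by Fatou's lemma. Hence
  $E_r(t) \to 0$ as $r \to \infty$ by dominated convergence, and Gronwall's inequality for $F_r$
  passes to the limit $M(t) \le e^{-ct} M(0)$ (\<open>second_moment_decay\<close>).\<close>

section \<open>Calculus of partial derivatives\<close>

lemma partial_eqI:
  assumes "(f has_derivative D) (at x)"
  shows "partial i f x = D (axis i 1)"
  using frechet_derivative_at[OF assms] by (simp add: partial_def)

lemma has_derivative_gradient:
  fixes f :: "real^'n \<Rightarrow> real"
  assumes "f differentiable (at x)"
  shows "(f has_derivative (\<lambda>v. gradient f x \<bullet> v)) (at x)"
proof -
  let ?D = "frechet_derivative f (at x)"
  have D: "(f has_derivative ?D) (at x)"
    using assms by (simp add: frechet_derivative_works)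
  then have lin: "linear ?D" by (rule has_derivative_linear)
  have "?D v = gradient f x \<bullet> v" for v
  proof -
    have "?D v = ?D (\<Sum>i\<in>UNIV. v $ i *\<^sub>R axis i 1)"
      by (simp add: basis_expansion flip: scalar_mult_eq_scaleR)
    also have "\<dots> = (\<Sum>i\<in>UNIV. v $ i * ?D (axis i 1))"
      using lin by (simp add: linear_sum linear_cmul)
    also have "\<dots> = gradient f x \<bullet> v"
      by (simp add: gradient_def partial_def inner_vec_def mult.commute)
    finally show ?thesis .
  qed
  then have "?D = (\<lambda>v. gradient f x \<bullet> v)" by blast
  with D show ?thesis by simp
qed

lemma Ck_Suc_imp_Ck: "Ck (Suc k) f \<Longrightarrow> Ck k f"
proof (induction k arbitrary: f)
  case 0
  then show ?case
    by (auto simp: continuous_on_eq_continuous_within intro: differentiable_imp_continuous_within)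
next
  case (Suc k)
  then show ?case by (auto simp del: Ck.simps(1))
qed

lemma Ck_const: "Ck k (\<lambda>x. c)"
proof (induction k arbitrary: c)
  case (Suc k)
  have "partial i (\<lambda>x::real^'a. c) = (\<lambda>x. 0)" for i
    by (rule ext, subst partial_eqI[OF has_derivative_const]) simp
  with Suc show ?case by simp
qed simp

lemma Ck_add: "Ck k f \<Longrightarrow> Ck k g \<Longrightarrow> Ck k (\<lambda>x. f x + g x)"
proof (induction k arbitrary: f g)
  case 0
  then show ?case by (auto intro: continuous_on_add)
next
  case (Suc k)
  have "partial i (\<lambda>x. f x + g x) = (\<lambda>x. partial i f x + partial i g x)" for i
  proof
    fix x
    show "partial i (\<lambda>x. f x + g x) x = partial i f x + partial i g x"
      using Suc.prems
      by (subst partial_eqI[OF has_derivative_add]) (auto simp: frechet_derivative_works partial_def)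
  qed
  with Suc show ?case by (auto intro: differentiable_add)
qed

lemma Ck_mult: "Ck k f \<Longrightarrow> Ck k g \<Longrightarrow> Ck k (\<lambda>x. f x * g x)"
proof (induction k arbitrary: f g)
  case 0
  then show ?case by (auto intro: continuous_on_mult)
next
  case (Suc k)
  have "partial i (\<lambda>x. f x * g x) = (\<lambda>x. f x * partial i g x + partial i f x * g x)" for i
  proof
    fix x
    show "partial i (\<lambda>x. f x * g x) x = f x * partial i g x + partial i f x * g x"
      using Suc.prems
      by (subst partial_eqI[OF has_derivative_mult]) (auto simp: frechet_derivative_works partial_def)
  qed
  moreover have "Ck k f" "Ck k g" using Suc.prems Ck_Suc_imp_Ck by blast+
  ultimately show ?case using Suc by (auto intro!: differentiable_mult Ck_add)
qed

lemma partial_compose: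
  assumes "f differentiable (at x)" "(g has_real_derivative d) (at (f x))"
  shows "partial i (\<lambda>x. g (f x)) x = d * partial i f x"
    and "(\<lambda>x. g (f x)) differentiable (at x)"
proof -
  have "((\<lambda>x. g (f x)) has_derivative (\<lambda>h. d * frechet_derivative f (at x) h)) (at x)"
    using assms has_derivative_compose[of f "frechet_derivative f (at x)" x UNIV g "(*) d"]
    by (auto simp: frechet_derivative_works has_field_derivative_def)
  then show "partial i (\<lambda>x. g (f x)) x = d * partial i f x"
    and "(\<lambda>x. g (f x)) differentiable (at x)"
    by (auto simp: partial_def differentiable_def dest: frechet_derivative_at[symmetric])
qed

text \<open>The outer function is given as a member of a sequence closed under differentiation, so that one
  induction over the order covers it together with all its derivatives.\<close>

lemma Ck_compose:
  assumes G: "\<And>n x. (G n has_real_derivative G (Suc n) x) (at x)"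
    and f: "\<And>k. Ck k f"
  shows "Ck k (\<lambda>x. G n (f x))"
proof (induction k arbitrary: n)
  case 0
  have "continuous_on UNIV (G n)"
    using G by (auto intro!: continuous_at_imp_continuous_on DERIV_isCont)
  with f[of 0] show ?case by (auto intro: continuous_on_compose2)
next
  case (Suc k)
  have d: "f differentiable (at x)" for x using f[of 1] by simp
  have "partial i (\<lambda>x. G n (f x)) = (\<lambda>x. G (Suc n) (f x) * partial i f x)" for i
    by (rule ext) (rule partial_compose[OF d G])
  moreover have "Ck k (partial i f)" for i using f[of "Suc k"] by simp
  ultimately show ?case
    using Suc by (auto intro!: Ck_mult partial_compose(2)[OF d G])
qed

lemma partial_affine: "partial i (\<lambda>x. c * (x $ j - b)) = (\<lambda>x. if i = j then c else 0)"
proof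
  fix x
  have "((\<lambda>x. c * (x $ j - b)) has_derivative (\<lambda>h. c * (h $ j))) (at x)"
    by (auto intro!: derivative_eq_intros bounded_linear.has_derivative[OF bounded_linear_vec_nth])
  then show "partial i (\<lambda>x. c * (x $ j - b)) x = (if i = j then c else 0)"
    using partial_eqI[of "\<lambda>x. c * (x $ j - b)" "\<lambda>h. c * (h $ j)" x i] by (simp add: axis_def)
qed

lemma Ck_affine: "Ck k (\<lambda>x. c * (x $ j - b))"
proof (cases k)
  case 0
  then show ?thesis by (auto intro!: continuous_intros)
next
  case (Suc k)
  have "(\<lambda>x::real^'a. c * (x $ j - b)) differentiable (at x)" for x
    unfolding differentiable_def
    by (rule exI[of _ "\<lambda>h. c * (h $ j)"])
      (auto intro!: derivative_eq_intros bounded_linear.has_derivative[OF bounded_linear_vec_nth])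
  with Suc Ck_const show ?thesis by (auto simp: partial_affine)
qed

lemma quadratic_has_derivative:
  fixes z :: "'a::real_inner"
  shows "((\<lambda>x. a + c * (norm (x - z))\<^sup>2 / 2) has_derivative (\<lambda>h. c * ((x - z) \<bullet> h))) (at x)"
  unfolding power2_norm_eq_inner
  by (auto intro!: derivative_eq_intros simp: inner_commute algebra_simps inner_simps diff_divide_distrib)

lemma partial_quadratic:
  "partial i (\<lambda>x. a + c * (norm (x - z))\<^sup>2 / 2) = (\<lambda>x. c * (x $ i - z $ i))"
  by (rule ext, subst partial_eqI[OF quadratic_has_derivative]) (simp add: inner_axis)

lemma Ck_quadratic: "Ck k (\<lambda>x::real^'n. a + c * (norm (x - z))\<^sup>2 / 2)"
proof (cases k)
  case 0
  then show ?thesis by (auto intro!: continuous_intros)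
next
  case (Suc k)
  then show ?thesis
    using quadratic_has_derivative[of a c z] Ck_affine[of k c]
    by (auto simp: partial_quadratic differentiable_def)
qed

section \<open>A smooth function that is convex up to one half\<close>

text \<open>The function $e^{-1/x}$, continued by zero, is smooth because the functions $q(1/x) e^{-1/x}$ with
  a polynomial $q$ form a class closed under differentiation.\<close>

definition poly_bump :: "real poly \<Rightarrow> real \<Rightarrow> real" where
  "poly_bump p x = (if x > 0 then poly p (1 / x) * exp (- 1 / x) else 0)"

text \<open>Exponential decay gives differentiability of the continued functions at the origin.\<close>

lemma poly_times_exp_neg_tendsto_0: "((\<lambda>u. poly p u * exp (- u)) \<longlongrightarrow> 0) (at_top :: real filter)"
proof -
  have "((\<lambda>u::real. \<Sum>i\<le>degree p. coeff p i * (u ^ i / exp u)) \<longlongrightarrow> (\<Sum>i\<le>degree p. coeff p i * 0)) at_top"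
    by (intro tendsto_intros tendsto_power_div_exp_0)
  then show ?thesis
    by (simp add: poly_altdef sum_distrib_right exp_minus divide_inverse mult.assoc)
qed

lemma poly_bump_has_real_derivative:
  "(poly_bump p has_real_derivative poly_bump ([:0, 0, 1:] * (p - pderiv p)) x) (at x)"
proof -
  consider "x > 0" | "x < 0" | "x = 0" by linarith
  then show ?thesis
  proof cases
    case 1
    have "((\<lambda>x. poly p (1 / x) * exp (- 1 / x)) has_real_derivative
        poly_bump ([:0, 0, 1:] * (p - pderiv p)) x) (at x)"
      using 1 by (auto intro!: derivative_eq_intros poly_DERIV[THEN DERIV_chain2]
          simp: poly_bump_def field_simps power2_eq_square)
    moreover have "\<forall>\<^sub>F y in nhds x. poly_bump p y = poly p (1 / y) * exp (- 1 / y)"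
      using eventually_nhds_in_open[of "{0<..}" x] 1
      by (auto elim!: eventually_mono simp: poly_bump_def)
    ultimately show ?thesis by (simp add: DERIV_cong_ev)
  next
    case 2
    have "\<forall>\<^sub>F y in nhds x. poly_bump p y = 0"
      using eventually_nhds_in_open[of "{..<0}" x] 2
      by (auto elim!: eventually_mono simp: poly_bump_def)
    then show ?thesis using 2 by (subst DERIV_cong_ev[where g = "\<lambda>_. 0"]) (auto simp: poly_bump_def)
  next
    case 3
    have r: "((\<lambda>h. poly_bump p h / h) \<longlongrightarrow> 0) (at_right 0)"
    proof -
      have "((\<lambda>h. poly (pCons 0 p) (inverse h) * exp (- inverse h)) \<longlongrightarrow> 0) (at_right 0)"
        by (rule filterlim_compose[OF poly_times_exp_neg_tendsto_0 filterlim_inverse_at_top_right])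
      then show ?thesis
        by (rule Lim_transform_eventually)
          (auto simp: eventually_at_filter poly_bump_def field_simps)
    qed
    have l: "((\<lambda>h. poly_bump p h / h) \<longlongrightarrow> 0) (at_left 0)"
      by (rule Lim_transform_eventually[OF tendsto_const])
        (auto simp: eventually_at_filter poly_bump_def)
    have "((\<lambda>h. poly_bump p h / h) \<longlongrightarrow> 0) (at 0)"
      using l r by (simp add: filterlim_split_at)
    then show ?thesis using 3 by (simp add: DERIV_def poly_bump_def)
  qed
qed

primrec bump_poly :: "nat \<Rightarrow> real poly" where
  "bump_poly 0 = 1"
| "bump_poly (Suc n) = [:0, 0, 1:] * (bump_poly n - pderiv (bump_poly n))"

text \<open>\<open>bump n\<close> is the $n$-th derivative of $e^{-1/x}$ (continued by zero).\<close>

definition bump :: "nat \<Rightarrow> real \<Rightarrow> real" where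
  "bump n = poly_bump (bump_poly n)"

lemma bump_has_real_derivative: "(bump n has_real_derivative bump (Suc n) x) (at x)"
  using poly_bump_has_real_derivative by (simp add: bump_def)

lemma bump_eq_0: "x \<le> 0 \<Longrightarrow> bump n x = 0"
  by (simp add: bump_def poly_bump_def)

lemma bump_0_nonneg: "0 \<le> bump 0 x"
  by (simp add: bump_def poly_bump_def)

lemma bump_1_pos: "x > 0 \<Longrightarrow> bump 1 x = exp (- 1 / x) / x\<^sup>2"
  by (simp add: bump_def poly_bump_def power2_eq_square pderiv_1)

lemma bump_1_nonneg: "0 \<le> bump 1 x"
  using bump_1_pos[of x] bump_eq_0[of x 1] by (cases "x > 0") auto

text \<open>Here the second derivative is $x^{-4} (1 - 2 x) e^{-1/x}$, which explains the bound one half.\<close>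

lemma bump_2_nonneg: "x \<le> 1 / 2 \<Longrightarrow> 0 \<le> bump 2 x"
proof (cases "x > 0")
  case True
  have "poly (bump_poly 2) u = u ^ 3 * (u - 2)" for u :: real
    by (simp add: numeral_2_eq_2 pderiv_1 pderiv_pCons power3_eq_cube algebra_simps)
  moreover assume "x \<le> 1 / 2"
  then have "1 / x \<ge> 2" using True by (simp add: field_simps)
  ultimately have "0 \<le> poly (bump_poly 2) (1 / x)" using True by simp
  then show ?thesis using True
    by (simp add: bump_def poly_bump_def)
qed (simp add: bump_eq_0)

lemma bump_1_mono: "x \<le> y \<Longrightarrow> y \<le> 1 / 2 \<Longrightarrow> bump 1 x \<le> bump 1 y"
  using bump_has_real_derivative[of 1] bump_2_nonneg
  by (intro DERIV_nonneg_imp_nondecreasing[of x y "bump 1"]) (force simp: numeral_2_eq_2)+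

lemma continuous_bump: "continuous_on S (bump n)"
  by (meson bump_has_real_derivative DERIV_isCont continuous_at_imp_continuous_on)

section \<open>Strongly convex functions and their proximal map\<close>

lemma is_arg_min_ARG_MIN:
  assumes "is_arg_min f P x"
  shows "is_arg_min f P (arg_min f P)"
  using assms unfolding arg_min_def by (rule someI)

lemma coercive_attains_min:
  fixes f :: "'a::euclidean_space \<Rightarrow> real"
  assumes f: "continuous_on UNIV f" and R: "\<And>y. R < norm (y - z) \<Longrightarrow> f z \<le> f y"
  shows "f (ARG_MIN f x. True) \<le> f y"
proof -
  let ?K = "cball z (max R 0)"
  have "continuous_on ?K f" using f by (rule continuous_on_subset) simp
  then obtain m where m: "m \<in> ?K" "\<And>y. y \<in> ?K \<Longrightarrow> f m \<le> f y"
    using continuous_attains_inf[of ?K f] by (auto simp del: mem_cball)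
  have "f m \<le> f y" for y
  proof (cases "y \<in> ?K")
    case False
    then have "f z \<le> f y" by (intro R) (auto simp: dist_norm norm_minus_commute)
    moreover have "f m \<le> f z" by (rule m(2)) simp
    ultimately show ?thesis by simp
  qed (rule m(2))
  then have "is_arg_min f (\<lambda>_. True) m" by (auto simp: is_arg_min_def not_less)
  from is_arg_min_ARG_MIN[OF this] show ?thesis by (auto simp: is_arg_min_def not_less)
qed

lemma DERIV_along_line:
  fixes V :: "real^'n \<Rightarrow> real"
  assumes "\<And>x. V differentiable (at x)"
  shows "((\<lambda>t. V (y + t *\<^sub>R v)) has_real_derivative gradient V (y + t *\<^sub>R v) \<bullet> v) (at t)"
proof -
  have "((\<lambda>t. V (y + t *\<^sub>R v)) has_derivative
      (\<lambda>s. gradient V (y + t *\<^sub>R v) \<bullet> (s *\<^sub>R v))) (at t)"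
    by (rule has_derivative_compose[OF _ has_derivative_gradient[OF assms]])
      (auto intro!: derivative_eq_intros)
  then show ?thesis
    by (simp add: has_field_derivative_def mult.commute mult_commute_abs)
qed

text \<open>The mean value theorem along the segment from \<open>y\<close> to \<open>x\<close>: the derivative of
  $\nabla V \cdot (x - y)$ along it is the Hessian form in the direction $x - y$.\<close>

lemma gradient_strongly_monotone:
  fixes x y :: "real^'n"
  assumes V: "Ck 2 V" and H: "\<And>x. \<mu> *\<^sub>R mat 1 \<preceq>\<^sub>L hessian V x"
  shows "\<mu> * (norm (x - y))\<^sup>2 \<le> (gradient V x - gradient V y) \<bullet> (x - y)"
proof -
  define v where "v = x - y"
  have d: "partial i V differentiable (at z)" for i z
    using V by (simp add: numeral_2_eq_2)
  have "((\<lambda>t. gradient V (y + t *\<^sub>R v) \<bullet> v) has_real_derivative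
      v \<bullet> (hessian V (y + t *\<^sub>R v) *v v)) (at t)" for t
  proof -
    have "((\<lambda>t. partial i V (y + t *\<^sub>R v)) has_real_derivative
        gradient (partial i V) (y + t *\<^sub>R v) \<bullet> v) (at t)" for i
      by (rule DERIV_along_line[OF d])
    then have "((\<lambda>t. \<Sum>i\<in>UNIV. partial i V (y + t *\<^sub>R v) * v $ i) has_real_derivative
        (\<Sum>i\<in>UNIV. gradient (partial i V) (y + t *\<^sub>R v) \<bullet> v * v $ i)) (at t)"
      by (intro DERIV_sum DERIV_cmult_right)
    moreover have "(\<Sum>i\<in>UNIV. gradient (partial i V) z \<bullet> v * v $ i) = v \<bullet> (hessian V z *v v)" for z
      unfolding gradient_def hessian_def inner_vec_def matrix_vector_mult_def
      by (simp add: sum_distrib_left sum_distrib_right) (subst sum.swap, simp add: ac_simps)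
    ultimately show ?thesis by (simp add: inner_vec_def gradient_def)
  qed
  then obtain t where t: "gradient V (y + 1 *\<^sub>R v) \<bullet> v - gradient V (y + 0 *\<^sub>R v) \<bullet> v
      = v \<bullet> (hessian V (y + t *\<^sub>R v) *v v)"
    using MVT2[of 0 1 "\<lambda>t. gradient V (y + t *\<^sub>R v) \<bullet> v"] by fastforce
  have "0 \<le> v \<bullet> ((hessian V z - \<mu> *\<^sub>R mat 1) *v v)" for z
    using H by (auto simp: loewner_le_def pos_semidef_def)
  then have "\<mu> * (v \<bullet> v) \<le> v \<bullet> (hessian V z *v v)" for z
    by (simp add: matrix_vector_mult_diff_rdistrib inner_diff_right flip: scaleR_matrix_vector_assoc)
  with t show ?thesis
    by (simp add: v_def inner_diff_left power2_norm_eq_inner)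
qed

text \<open>Strong monotonicity of the gradient is the form in which strong convexity enters.\<close>

locale strongly_convex =
  fixes V :: "real^'n \<Rightarrow> real" and \<mu> :: real
  assumes mu: "0 < \<mu>"
    and diff: "\<And>x. V differentiable (at x)"
    and mono: "\<And>x y. \<mu> * (norm (x - y))\<^sup>2 \<le> (gradient V x - gradient V y) \<bullet> (x - y)"
begin

lemma cont: "continuous_on UNIV V"
  using diff by (auto simp: continuous_on_eq_continuous_within intro: differentiable_imp_continuous_within)

text \<open>By monotonicity of the gradient, the difference of the two sides does not decrease along rays
  starting at \<open>z\<close>.\<close>

lemma quadratic_lower_bound: "V z + gradient V z \<bullet> (x - z) + \<mu> / 2 * (norm (x - z))\<^sup>2 \<le> V x"
proof -
  define v where "v = x - z"
  let ?f = "\<lambda>t. V (z + t *\<^sub>R v) - t * (gradient V z \<bullet> v) - \<mu> / 2 * t\<^sup>2 * (norm v)\<^sup>2"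
  let ?f' = "\<lambda>t. gradient V (z + t *\<^sub>R v) \<bullet> v - gradient V z \<bullet> v - \<mu> * t * (norm v)\<^sup>2"
  have "(?f has_real_derivative ?f' t) (at t)" for t
    by (auto intro!: derivative_eq_intros DERIV_along_line[OF diff])
  moreover have "0 \<le> ?f' t" if "0 \<le> t" for t
  proof (cases "t = 0")
    case False
    have "\<mu> * (t\<^sup>2 * (norm v)\<^sup>2) \<le> t * (gradient V (z + t *\<^sub>R v) \<bullet> v - gradient V z \<bullet> v)"
      using mono[of "z + t *\<^sub>R v" z] by (simp add: power_mult_distrib inner_diff_left)
    then have "0 \<le> t * ?f' t" by (simp add: algebra_simps power2_eq_square)
    with False that show ?thesis by (simp add: zero_le_mult_iff)
  qed simp
  ultimately have "?f 0 \<le> ?f 1"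
    using DERIV_nonneg_imp_nondecreasing[of 0 1 ?f] by (meson zero_le_one)
  then show ?thesis by (simp add: v_def)
qed

text \<open>A minimiser exists because the quadratic lower bound at the origin makes \<open>V\<close> coercive.\<close>

lemma minimum: "V (ARG_MIN V x. True) \<le> V y"
proof (rule coercive_attains_min[OF cont])
  fix y :: "real^'n" assume y: "2 * norm (gradient V 0) / \<mu> < norm (y - 0)"
  have "- (norm (gradient V 0) * norm y) \<le> gradient V 0 \<bullet> y"
    using Cauchy_Schwarz_ineq2[of "gradient V 0" y] by linarith
  moreover have "norm (gradient V 0) * norm y \<le> \<mu> / 2 * norm y * norm y"
    using y mu by (intro mult_right_mono) (auto simp: field_simps)
  ultimately show "V 0 \<le> V y"
    using quadratic_lower_bound[of 0 y] by (simp add: power2_eq_square)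
qed

lemma gradient_minimum: "gradient V (ARG_MIN V x. True) = 0"
proof -
  let ?z = "ARG_MIN V x. True"
  have "gradient V ?z \<bullet> v = 0" for v
    using DERIV_local_min[OF DERIV_along_line[OF diff, of ?z v 0], of 1] minimum by simp
  then show ?thesis by (metis inner_eq_zero_iff)
qed

context
  fixes \<kappa> :: real
  assumes kappa: "0 < \<kappa>" and nonneg: "\<And>x. 0 \<le> V x"
begin

lemma prox_minimum:
  "(norm (x - prox \<kappa> V x))\<^sup>2 / (2 * \<kappa>\<^sup>2) + V (prox \<kappa> V x) \<le> (norm (x - y))\<^sup>2 / (2 * \<kappa>\<^sup>2) + V y"
  unfolding prox_def
proof (rule coercive_attains_min)
  show "continuous_on UNIV (\<lambda>y. (norm (x - y))\<^sup>2 / (2 * \<kappa>\<^sup>2) + V y)"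
    using kappa by (intro continuous_intros cont) auto
  fix y assume "sqrt (2 * \<kappa>\<^sup>2 * V x) < norm (y - x)"
  then have "2 * \<kappa>\<^sup>2 * V x \<le> (norm (y - x))\<^sup>2" by (simp add: sqrt_le_D)
  then have "V x \<le> (norm (y - x))\<^sup>2 / (2 * \<kappa>\<^sup>2)" using kappa by (simp add: field_simps)
  then show "(norm (x - x))\<^sup>2 / (2 * \<kappa>\<^sup>2) + V x \<le> (norm (x - y))\<^sup>2 / (2 * \<kappa>\<^sup>2) + V y"
    using nonneg[of y] by (simp add: norm_minus_commute)
qed

text \<open>The first order condition at the minimum says that the proximal map is the resolvent
  $(I + \kappa^2 \nabla V)^{-1}$; the other properties of the map follow from it.\<close>

lemma prox_eq: "x - prox \<kappa> V x = \<kappa>\<^sup>2 *\<^sub>R gradient V (prox \<kappa> V x)"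
proof -
  let ?p = "prox \<kappa> V x"
  have "(\<kappa>\<^sup>2 *\<^sub>R gradient V ?p - (x - ?p)) \<bullet> v = 0" for v
  proof -
    let ?f = "\<lambda>t. (norm (x - (?p + t *\<^sub>R v)))\<^sup>2 / (2 * \<kappa>\<^sup>2) + V (?p + t *\<^sub>R v)"
    have "(?f has_real_derivative gradient V (?p + 0 *\<^sub>R v) \<bullet> v - (x - ?p) \<bullet> v / \<kappa>\<^sup>2) (at 0)"
      unfolding power2_norm_eq_inner using kappa
      by (auto intro!: derivative_eq_intros DERIV_along_line[OF diff, of ?p v 0, simplified]
          simp: inner_simps inner_commute diff_divide_distrib power4_eq_xxxx power2_eq_square)
    from DERIV_local_min[OF this, of 1] have "gradient V ?p \<bullet> v = (x - ?p) \<bullet> v / \<kappa>\<^sup>2"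
      using prox_minimum by simp
    then show ?thesis using kappa by (simp add: inner_diff_left)
  qed
  then show ?thesis by (metis inner_eq_zero_iff right_minus_eq)
qed

text \<open>Subtract the first order conditions at \<open>x\<close> and \<open>y\<close> and pair the result with the difference of
  the images: strong monotonicity bounds the right hand side from below.\<close>

lemma prox_contraction:
  "(1 + \<kappa>\<^sup>2 * \<mu>) * norm (prox \<kappa> V x - prox \<kappa> V y) \<le> norm (x - y)"
proof -
  let ?q = "prox \<kappa> V x - prox \<kappa> V y"
  have "(x - y) - ?q = \<kappa>\<^sup>2 *\<^sub>R (gradient V (prox \<kappa> V x) - gradient V (prox \<kappa> V y))"
    using prox_eq[of x] prox_eq[of y] by (simp add: algebra_simps)
  then have "((x - y) - ?q) \<bullet> ?q
      = \<kappa>\<^sup>2 * ((gradient V (prox \<kappa> V x) - gradient V (prox \<kappa> V y)) \<bullet> ?q)" by simp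
  also have "\<dots> \<ge> \<kappa>\<^sup>2 * (\<mu> * (norm ?q)\<^sup>2)" by (intro mult_left_mono mono) simp
  finally have "(1 + \<kappa>\<^sup>2 * \<mu>) * (norm ?q)\<^sup>2 \<le> (x - y) \<bullet> ?q"
    by (simp add: inner_diff_left power2_norm_eq_inner algebra_simps)
  also have "\<dots> \<le> norm (x - y) * norm ?q" by (rule norm_cauchy_schwarz)
  finally have "((1 + \<kappa>\<^sup>2 * \<mu>) * norm ?q) * norm ?q \<le> norm (x - y) * norm ?q"
    by (simp add: power2_eq_square mult.assoc)
  then show ?thesis
    by (cases "?q = 0") auto
qed

lemma continuous_prox: "continuous_on S (prox \<kappa> V)"
proof -
  have "norm (prox \<kappa> V x - prox \<kappa> V y) \<le> norm (x - y)" for x y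
  proof -
    have "1 * norm (prox \<kappa> V x - prox \<kappa> V y) \<le> (1 + \<kappa>\<^sup>2 * \<mu>) * norm (prox \<kappa> V x - prox \<kappa> V y)"
      using mu by (intro mult_right_mono) auto
    with prox_contraction[of x y] show ?thesis by simp
  qed
  then show ?thesis
    by (intro lipschitz_on_continuous_on[of 1]) (auto simp: lipschitz_on_def dist_norm)
qed

text \<open>Pairing the first order condition at \<open>p = prox \<kappa> V z\<close> with $p - z$ gives
  $-|p - z|^2 = \kappa^2 \nabla V(p) \cdot (p - z)$, where monotonicity makes the right hand side
  nonnegative, as the gradient vanishes at the minimiser $z$.\<close>

lemma prox_minimizer: "prox \<kappa> V (ARG_MIN V x. True) = (ARG_MIN V x. True)" (is "?p = ?z")
proof -
  have "0 \<le> \<mu> * (norm (?p - ?z))\<^sup>2" using mu by simp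
  also have "\<dots> \<le> gradient V ?p \<bullet> (?p - ?z)"
    using mono[of ?p ?z] by (simp add: gradient_minimum)
  finally have "0 \<le> \<kappa>\<^sup>2 * (gradient V ?p \<bullet> (?p - ?z))" by simp
  also have "\<dots> = (?z - ?p) \<bullet> (?p - ?z)" by (simp flip: prox_eq inner_scaleR_left)
  also have "\<dots> = - (norm (?p - ?z))\<^sup>2"
    by (simp add: power2_norm_eq_inner flip: inner_minus_left)
  finally show ?thesis by simp
qed

end

end

section \<open>Concave truncations of the squared distance\<close>

text \<open>With $s = |x - z|^2$, the value of \<open>cutoff\<close> is $\frac12 - \frac{s}{2r}$: it stays in the interval
  where \<open>bump 0\<close> is convex, and it is not positive, so that \<open>bump 0\<close> vanishes, for $s \ge r$. It is
  written as a quadratic with coefficient $-1/r$ to fit the rules for quadratics above.\<close>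

definition cutoff :: "real^'n \<Rightarrow> real \<Rightarrow> real^'n \<Rightarrow> real" where
  "cutoff z r x = 1 / 2 + (- 1 / r) * (norm (x - z))\<^sup>2 / 2"

text \<open>\<open>trunc\<close> is $h_r(s)$ and \<open>slope\<close> is $h_r'(s)$ at $s = |x - z|^2$; the factor $e^2/2$ normalises
  $h_r'(0) = 1$.\<close>

definition trunc :: "real^'n \<Rightarrow> real \<Rightarrow> real^'n \<Rightarrow> real" where
  "trunc z r x = r * (exp 2 / 2) * (bump 0 (1 / 2) - bump 0 (cutoff z r x))"

definition slope :: "real^'n \<Rightarrow> real \<Rightarrow> real^'n \<Rightarrow> real" where
  "slope z r x = exp 2 / 4 * bump 1 (cutoff z r x)"

lemma continuous_cutoff: "continuous_on S (cutoff z r)"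
  unfolding cutoff_def divide_inverse by (intro continuous_intros)

lemma continuous_bump_cutoff: "continuous_on S (\<lambda>x. bump n (cutoff z r x))"
  by (rule continuous_on_compose2[OF continuous_bump[of UNIV] continuous_cutoff]) simp

lemma bump_cutoff_eq_0: "0 < r \<Longrightarrow> r \<le> (norm (x - z))\<^sup>2 \<Longrightarrow> bump n (cutoff z r x) = 0"
  by (rule bump_eq_0) (simp add: cutoff_def field_simps)

lemma cutoff_le: "0 < r \<Longrightarrow> cutoff z r x \<le> 1 / 2"
  by (simp add: cutoff_def)

lemma cutoff_differentiable: "cutoff z r differentiable (at x)"
  unfolding differentiable_def cutoff_def using quadratic_has_derivative by blast

lemma partial_bump_cutoff:
  "partial i (\<lambda>x. bump n (cutoff z r x)) = (\<lambda>x. bump (Suc n) (cutoff z r x) * (- 1 / r * (x $ i - z $ i)))"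
proof
  fix x
  have "partial i (cutoff z r) x = - 1 / r * (x $ i - z $ i)"
    unfolding cutoff_def[abs_def] by (simp only: partial_quadratic)
  then show "partial i (\<lambda>x. bump n (cutoff z r x)) x = bump (Suc n) (cutoff z r x) * (- 1 / r * (x $ i - z $ i))"
    by (simp only: partial_compose(1)[OF cutoff_differentiable bump_has_real_derivative])
qed

lemma test_function_bump_cutoff:
  assumes "0 < r"
  shows "test_function (\<lambda>x. bump 0 (cutoff z r x))"
  unfolding test_function_def
proof (intro conjI allI)
  fix k
  show "Ck k (\<lambda>x. bump 0 (cutoff z r x))"
    unfolding cutoff_def
    by (rule Ck_compose) (rule bump_has_real_derivative Ck_quadratic)+
  have "{x. bump 0 (cutoff z r x) \<noteq> 0} \<subseteq> cball z (sqrt r)"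
  proof
    fix x assume "x \<in> {x. bump 0 (cutoff z r x) \<noteq> 0}"
    then have "(norm (x - z))\<^sup>2 < r"
      using bump_cutoff_eq_0[OF assms, of x z 0] by (auto simp: not_le[symmetric])
    then show "x \<in> cball z (sqrt r)"
      by (simp add: dist_norm norm_minus_commute real_le_rsqrt)
  qed
  then have "bounded {x. bump 0 (cutoff z r x) \<noteq> 0}" by (rule bounded_subset[OF bounded_cball])
  then show "compact (closure {x. bump 0 (cutoff z r x) \<noteq> 0})" by simp
qed

lemma gradient_bump_cutoff:
  "gradient (\<lambda>x. bump 0 (cutoff z r x)) x = (- bump 1 (cutoff z r x) / r) *\<^sub>R (x - z)"
  by (simp add: gradient_def partial_bump_cutoff vec_eq_iff)

lemma laplacian_bump_cutoff:
  "laplacian (\<lambda>x. bump 0 (cutoff z r x)) x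
    = bump 2 (cutoff z r x) * ((norm (x - z))\<^sup>2 / r\<^sup>2) - real CARD('n) * (bump 1 (cutoff z r x) / r)"
  for z x :: "real^'n"
proof -
  have "partial i (\<lambda>x. bump 1 (cutoff z r x) * (- 1 / r * (x $ i - z $ i))) x
      = bump 2 (cutoff z r x) * ((x $ i - z $ i)\<^sup>2 / r\<^sup>2) - bump 1 (cutoff z r x) / r" for i
  proof -
    from partial_compose(2)[OF cutoff_differentiable bump_has_real_derivative[of 1]]
    have 1: "((\<lambda>x. bump 1 (cutoff z r x)) has_derivative
        frechet_derivative (\<lambda>x. bump 1 (cutoff z r x)) (at x)) (at x)"
      by (simp add: frechet_derivative_works)
    have 2: "((\<lambda>x. - 1 / r * (x $ i - z $ i)) has_derivative (\<lambda>h. - 1 / r * (h $ i))) (at x)"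
      by (rule has_derivative_mult_right)
        (auto intro!: derivative_eq_intros bounded_linear.has_derivative[OF bounded_linear_vec_nth])
    have "frechet_derivative (\<lambda>x. bump 1 (cutoff z r x)) (at x) (axis i 1)
        = bump 2 (cutoff z r x) * (- 1 / r * (x $ i - z $ i))"
      using partial_bump_cutoff[of i 1 z r] by (simp add: partial_def fun_eq_iff numeral_2_eq_2)
    then show ?thesis
      unfolding partial_eqI[OF has_derivative_mult[OF 1 2]]
      by (simp add: power2_eq_square)
  qed
  then have "laplacian (\<lambda>x. bump 0 (cutoff z r x)) x
      = (\<Sum>i\<in>UNIV. bump 2 (cutoff z r x) * ((x $ i - z $ i)\<^sup>2 / r\<^sup>2) - bump 1 (cutoff z r x) / r)"
    by (simp add: laplacian_def partial_bump_cutoff)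
  also have "\<dots> = bump 2 (cutoff z r x) * ((\<Sum>i\<in>UNIV. (x $ i - z $ i)\<^sup>2) / r\<^sup>2)
      - real CARD('n) * (bump 1 (cutoff z r x) / r)"
    by (simp add: sum_subtractf sum_distrib_left sum_divide_distrib[of _ _ "r\<^sup>2"])
  also have "(\<Sum>i\<in>UNIV. (x $ i - z $ i)\<^sup>2) = (norm (x - z))\<^sup>2"
    unfolding power2_norm_eq_inner inner_vec_def by (simp add: power2_eq_square)
  finally show ?thesis .
qed

lemma slope_nonneg: "0 \<le> slope z r x"
  unfolding slope_def by (intro mult_nonneg_nonneg bump_1_nonneg) simp

text \<open>Concavity of $h_r$ with $h_r(0) = 0$ and $h_r'(0) = 1$ puts $h_r(s)$ between $s h_r'(s)$ and $s$.
  Both inequalities come from the mean value theorem, as \<open>bump 1\<close> is nondecreasing up to one half.\<close>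

lemma slope_bounds:
  assumes "0 < r"
  shows "slope z r x * (norm (x - z))\<^sup>2 \<le> trunc z r x" "trunc z r x \<le> (norm (x - z))\<^sup>2"
proof -
  let ?w = "cutoff z r x" and ?s = "(norm (x - z))\<^sup>2"
  have "\<exists>\<xi>. ?w \<le> \<xi> \<and> \<xi> \<le> 1 / 2 \<and> bump 0 (1 / 2) - bump 0 ?w = (1 / 2 - ?w) * bump 1 \<xi>"
  proof (cases "?w = 1 / 2")
    case True
    show ?thesis by (intro exI[of _ "1 / 2"]) (simp only: True, simp)
  next
    case False
    then have "?w < 1 / 2" using cutoff_le[OF assms, of z x] by simp
    from MVT2[OF this, of "bump 0" "bump (Suc 0)"] bump_has_real_derivative[of 0]
    obtain \<xi> where "?w < \<xi>" "\<xi> < 1 / 2" "bump 0 (1 / 2) - bump 0 ?w = (1 / 2 - ?w) * bump 1 \<xi>"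
      by auto
    then show ?thesis by (intro exI[of _ \<xi>]) simp
  qed
  then obtain \<xi> where \<xi>: "?w \<le> \<xi>" "\<xi> \<le> 1 / 2"
      "bump 0 (1 / 2) - bump 0 ?w = (1 / 2 - ?w) * bump 1 \<xi>" by blast
  have "trunc z r x = r * (exp 2 / 2) * ((1 / 2 - ?w) * bump 1 \<xi>)"
    by (simp add: trunc_def \<xi>(3))
  also have "\<dots> = exp 2 / 4 * bump 1 \<xi> * ?s"
    using assms by (simp add: cutoff_def)
  finally have t: "trunc z r x = exp 2 / 4 * bump 1 \<xi> * ?s" .
  show "slope z r x * ?s \<le> trunc z r x"
    unfolding t slope_def using \<xi> by (intro mult_right_mono mult_left_mono bump_1_mono) auto
  have "exp 2 / 4 * bump 1 \<xi> \<le> exp 2 / 4 * bump 1 (1 / 2)"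
    using \<xi> by (intro mult_left_mono bump_1_mono) auto
  also have "\<dots> = 1"
    using bump_1_pos[of "1 / 2"] by (simp add: power2_eq_square flip: exp_add)
  finally show "trunc z r x \<le> ?s"
    unfolding t using mult_right_mono[of "exp 2 / 4 * bump 1 \<xi>" 1 ?s] by simp
qed

lemma trunc_nonneg: "0 < r \<Longrightarrow> 0 \<le> trunc z r x"
  using slope_bounds(1)[of r z x] slope_nonneg[of z r x] by (meson mult_nonneg_nonneg order_trans zero_le_power2)

lemma slope_tendsto_1: "(\<lambda>n. slope z (real (Suc n)) x) \<longlonglongrightarrow> 1"
proof -
  have eq: "cutoff z r x = 1 / 2 - (norm (x - z))\<^sup>2 / 2 * inverse r" for r
    by (simp add: cutoff_def inverse_eq_divide)
  have "(\<lambda>n. 1 / 2 - (norm (x - z))\<^sup>2 / 2 * inverse (real (Suc n))) \<longlonglongrightarrow> 1 / 2 - (norm (x - z))\<^sup>2 / 2 * 0"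
    by (intro tendsto_intros LIMSEQ_inverse_real_of_nat)
  then have "(\<lambda>n. cutoff z (real (Suc n)) x) \<longlonglongrightarrow> 1 / 2"
    by (simp only: eq mult_zero_right diff_zero)
  moreover have "isCont (bump 1) (1 / 2)"
    using bump_has_real_derivative DERIV_isCont by blast
  ultimately have "(\<lambda>n. exp 2 / 4 * bump 1 (cutoff z (real (Suc n)) x)) \<longlonglongrightarrow> exp 2 / 4 * bump 1 (1 / 2)"
    by (intro tendsto_mult tendsto_const isCont_tendsto_compose[of _ "bump 1"])
  moreover have "exp 2 / 4 * bump 1 (1 / 2) = 1"
    using bump_1_pos[of "1 / 2"] by (simp add: power2_eq_square flip: exp_add)
  ultimately show ?thesis by (simp add: slope_def)
qed

lemma trunc_tendsto: "(\<lambda>n. trunc z (real (Suc n)) x) \<longlonglongrightarrow> (norm (x - z))\<^sup>2"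
proof (rule tendsto_sandwich)
  show "(\<lambda>n. slope z (real (Suc n)) x * (norm (x - z))\<^sup>2) \<longlonglongrightarrow> (norm (x - z))\<^sup>2"
    using tendsto_mult[OF slope_tendsto_1[of z x] tendsto_const[of "(norm (x - z))\<^sup>2"]] by (simp only: mult_1)
  show "(\<lambda>n. (norm (x - z))\<^sup>2) \<longlonglongrightarrow> (norm (x - z))\<^sup>2" by (rule tendsto_const)
  show "\<forall>\<^sub>F n in sequentially. slope z (real (Suc n)) x * (norm (x - z))\<^sup>2 \<le> trunc z (real (Suc n)) x"
    "\<forall>\<^sub>F n in sequentially. trunc z (real (Suc n)) x \<le> (norm (x - z))\<^sup>2"
    by (intro always_eventually allI slope_bounds, simp)+
qed

lemma continuous_trunc: "continuous_on S (trunc z r)"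
  unfolding trunc_def by (intro continuous_intros continuous_bump_cutoff)

lemma continuous_slope: "continuous_on S (slope z r)"
  unfolding slope_def by (intro continuous_intros continuous_bump_cutoff)

lemma compactly_supported_bounded:
  fixes f :: "'a::euclidean_space \<Rightarrow> real"
  assumes "continuous_on UNIV f" "\<And>x. s \<le> (norm (x - z))\<^sup>2 \<Longrightarrow> f x = 0"
  shows "bounded (range f)"
proof -
  have "range f \<subseteq> insert 0 (f ` cball z (sqrt s))"
  proof
    fix y assume "y \<in> range f"
    then obtain x where y: "y = f x" by blast
    show "y \<in> insert 0 (f ` cball z (sqrt s))"
    proof (cases "s \<le> (norm (x - z))\<^sup>2")
      case True
      then show ?thesis using assms(2) y by simp
    next
      case False
      then have "x \<in> cball z (sqrt s)"
        by (simp add: dist_norm norm_minus_commute real_le_rsqrt)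
      then show ?thesis using y by blast
    qed
  qed
  moreover have "compact (f ` cball z (sqrt s))"
    by (intro compact_continuous_image continuous_on_subset[OF assms(1)]) auto
  ultimately show ?thesis
    by (meson bounded_insert bounded_subset compact_imp_bounded)
qed

lemma bounded_trunc:
  assumes "0 < r"
  shows "bounded (range (trunc z r))"
proof -
  have "trunc z r x \<le> r * (exp 2 / 2) * bump 0 (1 / 2)" for x
    unfolding trunc_def using assms bump_0_nonneg[of "cutoff z r x"] by (intro mult_left_mono) auto
  then have "norm (trunc z r x) \<le> r * (exp 2 / 2) * bump 0 (1 / 2)" for x
    using trunc_nonneg[OF assms, of z x] by (simp add: abs_of_nonneg)
  then show ?thesis unfolding bounded_iff by blast
qed

lemma integrable_bounded_continuous:
  fixes f :: "'a::topological_space \<Rightarrow> real"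
  assumes "borel_prob M" "continuous_on UNIV f" "bounded (range f)"
  shows "integrable M f"
proof -
  interpret prob_space M using assms(1) by (simp add: borel_prob_def)
  obtain B where "\<And>x. norm (f x) \<le> B" using assms(3) by (auto simp: bounded_iff)
  moreover have "f \<in> borel_measurable M"
    using borel_measurable_continuous_onI[OF assms(2)] assms(1) measurable_cong_sets
    unfolding borel_prob_def by blast
  ultimately show ?thesis by (intro integrable_const_bound[of f B]) auto
qed

text \<open>Dissipation produces $s h_r'(s)$ rather than $h_r(s)$. Their difference, bounded and continuous
  because $h_r$ is constant for $s \ge r$, is the error term in the differential inequality for the
  truncated moment.\<close>

definition remainder :: "real^'n \<Rightarrow> real \<Rightarrow> real^'n \<Rightarrow> real" where
  "remainder z r x = trunc z r x - slope z r x * (norm (x - z))\<^sup>2"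

lemma continuous_remainder: "continuous_on S (remainder z r)"
  unfolding remainder_def by (intro continuous_intros continuous_trunc continuous_slope)

lemma bounded_slope_times:
  assumes "0 < r" "continuous_on UNIV f"
  shows "bounded (range (\<lambda>x. slope z r x * f x))"
  using assms
  by (intro compactly_supported_bounded[of _ r z] continuous_intros continuous_slope)
    (auto simp: slope_def bump_cutoff_eq_0)

lemma bounded_remainder: "0 < r \<Longrightarrow> bounded (range (remainder z r))"
  unfolding remainder_def
  by (intro bounded_minus_comp bounded_trunc bounded_slope_times continuous_intros)

lemma remainder_bounds:
  assumes "0 < r"
  shows "0 \<le> remainder z r x" "remainder z r x \<le> trunc z r x"
  using slope_bounds(1)[OF assms, of z x] slope_nonneg[of z r x]
  by (auto simp: remainder_def)

lemma remainder_tendsto: "(\<lambda>n. remainder z (real (Suc n)) x) \<longlonglongrightarrow> 0"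
proof -
  have "(\<lambda>n. remainder z (real (Suc n)) x) \<longlonglongrightarrow> (norm (x - z))\<^sup>2 - 1 * (norm (x - z))\<^sup>2"
    unfolding remainder_def by (intro tendsto_intros trunc_tendsto slope_tendsto_1)
  then show ?thesis by simp
qed

section \<open>Decay of the second moment\<close>

text \<open>The assumption \<open>dissipation\<close> is the Lyapunov condition for $|x - z|^2$: its left hand side is the
  adjoint of the Fokker--Planck operator applied to that function.\<close>

locale dissipative_FP =
  fixes \<sigma> c :: real and p :: "real^'n \<Rightarrow> real^'n" and z :: "real^'n" and \<rho> :: "real \<Rightarrow> (real^'n) measure"
  assumes solution: "FP_weak_solution \<sigma> p \<rho>"
    and cont_p: "continuous_on UNIV p"
    and c_pos: "0 < c"
    and dissipation: "\<And>x. \<sigma>\<^sup>2 * real CARD('n) * (norm (x - p x))\<^sup>2 - 2 * ((x - z) \<bullet> (x - p x))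
        \<le> - c * (norm (x - z))\<^sup>2"
    and initial: "(\<integral>\<^sup>+ x. ennreal ((norm (x - z))\<^sup>2) \<partial>\<rho> 0) < \<infinity>"
begin

abbreviation F :: "real \<Rightarrow> real \<Rightarrow> real" where "F r t \<equiv> (\<integral>x. trunc z r x \<partial>\<rho> t)"
abbreviation E :: "real \<Rightarrow> real \<Rightarrow> real" where "E r t \<equiv> (\<integral>x. remainder z r x \<partial>\<rho> t)"
abbreviation M0 :: real where "M0 \<equiv> (\<integral>x. (norm (x - z))\<^sup>2 \<partial>\<rho> 0)"

lemma rho: "0 \<le> t \<Longrightarrow> prob_space (\<rho> t)" "0 \<le> t \<Longrightarrow> sets (\<rho> t) = sets borel"
  using solution by (auto simp: FP_weak_solution_def borel_prob_def)

lemma measurable_rho: "0 \<le> t \<Longrightarrow> f \<in> borel_measurable borel \<Longrightarrow> f \<in> borel_measurable (\<rho> t)"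
  by (simp add: measurable_cong_sets[OF rho(2) refl])

lemma integrable_rho:
  fixes f :: "real^'n \<Rightarrow> real"
  shows "0 \<le> t \<Longrightarrow> continuous_on UNIV f \<Longrightarrow> bounded (range f) \<Longrightarrow> integrable (\<rho> t) f"
  using solution by (intro integrable_bounded_continuous) (auto simp: FP_weak_solution_def)

lemma continuous_in_time:
  fixes f :: "real^'n \<Rightarrow> real"
  shows "continuous_on UNIV f \<Longrightarrow> bounded (range f) \<Longrightarrow> continuous_on {0..} (\<lambda>t. \<integral>x. f x \<partial>\<rho> t)"
  using solution by (auto simp: FP_weak_solution_def narrowly_continuous_def)

text \<open>Up to a constant, \<open>trunc\<close> is a multiple of a test function. Its image under the adjoint operator is
  $h_r'(s) \big(d \sigma^2 |b|^2 - 2 (x - z) \cdot b\big) + 2 \sigma^2 s h_r''(s) |b|^2$, and the last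
  term is not positive since $h_r$ is concave. By dissipation the first one is at most
  $- c s h_r'(s)$.\<close>

lemma F_derivative:
  assumes r: "0 < r" and t: "0 < t"
  shows "\<exists>d. (F r has_real_derivative d) (at t) \<and> d \<le> - c * (F r t - E r t)"
proof -
  let ?w = "cutoff z r"
  let ?\<phi> = "\<lambda>x. bump 0 (?w x)" and ?b = "\<lambda>x. x - p x" and ?d = "real CARD('n)"
  have t': "0 \<le> t" using t by simp
  have prob: "prob_space (\<rho> s)" if "0 \<le> s" for s using rho that by blast
  have supp: "integrable (\<rho> s) (\<lambda>x. bump n (?w x) * f x)"
    if "continuous_on UNIV f" "0 \<le> s" for n f s
    using that r
    by (intro integrable_rho compactly_supported_bounded[of _ r z] continuous_intros continuous_bump_cutoff)
      (auto simp: bump_cutoff_eq_0)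
  define A where "A = (\<integral>x. gradient ?\<phi> x \<bullet> ?b x \<partial>\<rho> t)"
  define B where "B = (\<integral>x. laplacian ?\<phi> x * (norm (?b x))\<^sup>2 \<partial>\<rho> t)"
  have "((\<lambda>s. \<integral>x. ?\<phi> x \<partial>\<rho> s) has_real_derivative (- A + \<sigma>\<^sup>2 / 2 * B)) (at t)"
    using solution test_function_bump_cutoff[OF r, of z] t by (auto simp: FP_weak_solution_def A_def B_def)
  then have "((\<lambda>s. r * (exp 2 / 2) * (bump 0 (1 / 2) - (\<integral>x. ?\<phi> x \<partial>\<rho> s))) has_real_derivative
      - (r * (exp 2 / 2) * (- A + \<sigma>\<^sup>2 / 2 * B))) (at t)"
    using DERIV_cmult[OF DERIV_diff[OF DERIV_const], of _ _ t UNIV "r * (exp 2 / 2)" "bump 0 (1 / 2)"]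
    by (simp only: diff_0 mult_minus_right)
  moreover have "\<forall>\<^sub>F s in nhds t. F r s = r * (exp 2 / 2) * (bump 0 (1 / 2) - (\<integral>x. ?\<phi> x \<partial>\<rho> s))"
  proof (rule eventually_mono[OF eventually_nhds_in_open[of "{0<..}" t]])
    fix s :: real assume "s \<in> {0<..}"
    then have s: "0 \<le> s" by simp
    interpret prob_space "\<rho> s" using prob[OF s] .
    have "integrable (\<rho> s) ?\<phi>" using supp[of "\<lambda>_. 1" s 0] s by simp
    then show "F r s = r * (exp 2 / 2) * (bump 0 (1 / 2) - (\<integral>x. ?\<phi> x \<partial>\<rho> s))"
      unfolding trunc_def by (simp add: prob_space)
  qed (use t in auto)
  ultimately have D: "(F r has_real_derivative - (r * (exp 2 / 2) * (- A + \<sigma>\<^sup>2 / 2 * B))) (at t)"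
    by (subst DERIV_cong_ev[OF refl _ refl])
  have iA: "integrable (\<rho> t) (\<lambda>x. gradient ?\<phi> x \<bullet> ?b x)"
    using supp[of "\<lambda>x. - 1 / r * ((x - z) \<bullet> ?b x)" t 1] t r cont_p
    by (simp add: gradient_bump_cutoff continuous_intros)
  have "integrable (\<rho> t) (\<lambda>x. bump 2 (?w x) * ((norm (x - z))\<^sup>2 / r\<^sup>2 * (norm (?b x))\<^sup>2)
      - bump 1 (?w x) * (?d / r * (norm (?b x))\<^sup>2))"
    using t r by (intro Bochner_Integration.integrable_diff supp continuous_intros cont_p) auto
  then have iB: "integrable (\<rho> t) (\<lambda>x. laplacian ?\<phi> x * (norm (?b x))\<^sup>2)"
    by (simp add: laplacian_bump_cutoff algebra_simps)
  have iS: "integrable (\<rho> t) (\<lambda>x. slope z r x * (norm (x - z))\<^sup>2)"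
    using r t' by (intro integrable_rho bounded_slope_times continuous_intros continuous_slope)
  have iT: "integrable (\<rho> t) (trunc z r)"
    using r t' by (intro integrable_rho bounded_trunc continuous_trunc)
  have "- (r * (exp 2 / 2) * (- A + \<sigma>\<^sup>2 / 2 * B))
      = (\<integral>x. - (r * (exp 2 / 2) * (- (gradient ?\<phi> x \<bullet> ?b x) + \<sigma>\<^sup>2 / 2 * (laplacian ?\<phi> x * (norm (?b x))\<^sup>2))) \<partial>\<rho> t)"
    using iA iB by (simp add: A_def B_def)
  also have "\<dots> \<le> (\<integral>x. - c * (slope z r x * (norm (x - z))\<^sup>2) \<partial>\<rho> t)"
  proof (rule integral_mono)
    fix x
    let ?s = "(norm (x - z))\<^sup>2" and ?q = "(norm (?b x))\<^sup>2" and ?g = "\<lambda>n. bump n (?w x)"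
    have inner: "gradient ?\<phi> x \<bullet> ?b x = - (bump 1 (?w x) / r * ((x - z) \<bullet> ?b x))"
      by (simp only: gradient_bump_cutoff inner_scaleR_left minus_divide_left mult_minus_left)
    have "- (r * (exp 2 / 2) * (- (gradient ?\<phi> x \<bullet> ?b x) + \<sigma>\<^sup>2 / 2 * (laplacian ?\<phi> x * ?q)))
        = slope z r x * (\<sigma>\<^sup>2 * ?d * ?q - 2 * ((x - z) \<bullet> ?b x))
          - exp 2 / 4 * \<sigma>\<^sup>2 * ?g 2 * ?s * ?q / r"
      unfolding inner laplacian_bump_cutoff slope_def
      using r by (simp add: power2_eq_square[of r] field_simps)
    also have "\<dots> \<le> slope z r x * (\<sigma>\<^sup>2 * ?d * ?q - 2 * ((x - z) \<bullet> ?b x))"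
    proof -
      have "0 \<le> exp 2 / 4 * \<sigma>\<^sup>2 * ?g 2 * ?s * ?q / r"
        using r by (intro divide_nonneg_pos mult_nonneg_nonneg bump_2_nonneg cutoff_le) auto
      then show ?thesis by simp
    qed
    also have "\<dots> \<le> slope z r x * (- c * ?s)"
      by (intro mult_left_mono dissipation slope_nonneg)
    also have "\<dots> = - c * (slope z r x * ?s)" by (simp add: mult.left_commute)
    finally show "- (r * (exp 2 / 2) * (- (gradient ?\<phi> x \<bullet> ?b x) + \<sigma>\<^sup>2 / 2 * (laplacian ?\<phi> x * ?q)))
        \<le> - c * (slope z r x * ?s)" .
  qed (use iA iB iS in auto)
  also have "\<dots> = - c * (F r t - E r t)"
    using iT iS by (simp add: remainder_def[abs_def])
  finally show ?thesis using D by blast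
qed

lemma initial_integrable: "integrable (\<rho> 0) (\<lambda>x. (norm (x - z))\<^sup>2)"
  using initial by (intro integrableI_bounded measurable_rho) auto

lemma F_initial: "0 < r \<Longrightarrow> F r 0 \<le> M0"
  by (intro integral_mono initial_integrable integrable_rho bounded_trunc continuous_trunc slope_bounds) auto

lemma F_continuous: "0 < r \<Longrightarrow> continuous_on {0..} (F r)"
  by (intro continuous_in_time bounded_trunc continuous_trunc)

lemma E_continuous: "0 < r \<Longrightarrow> continuous_on {0..} (E r)"
  by (intro continuous_in_time bounded_remainder continuous_remainder)

lemma E_bounds:
  assumes "0 < r" "0 \<le> t" shows "0 \<le> E r t" "E r t \<le> F r t"
  using assms by (auto intro!: integral_nonneg_AE integral_mono integrable_rho remainder_bounds
      bounded_remainder continuous_remainder bounded_trunc continuous_trunc)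

lemma F_le_M0:
  assumes r: "0 < r" and t: "0 \<le> t"
  shows "F r t \<le> M0"
proof (cases "t = 0")
  case False
  have "F r t \<le> F r 0"
  proof (rule DERIV_nonpos_imp_decreasing_open[where f = "F r"])
    show "0 \<le> t" by (rule t)
    show "continuous_on {0..t} (F r)"
      by (rule continuous_on_subset[OF F_continuous[OF r]]) auto
    fix s assume s: "0 < s" "s < t"
    have "- c * (F r s - E r s) \<le> 0" using c_pos E_bounds[OF r, of s] s by simp
    with F_derivative[OF r s(1)] show "\<exists>y. (F r has_real_derivative y) (at s) \<and> y \<le> 0"
      by (meson order_trans)
  qed
  then show ?thesis using F_initial[OF r] by simp
qed (use F_initial[OF r] in simp)

text \<open>Fatou's lemma transfers bounds for the truncated moments to the second moment.\<close>

lemma second_moment_le: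
  assumes t: "0 \<le> t" and F: "\<And>n. F (real (Suc n)) t \<le> B n" and B: "B \<longlonglongrightarrow> b"
  shows "(\<integral>\<^sup>+ x. ennreal ((norm (x - z))\<^sup>2) \<partial>\<rho> t) \<le> ennreal b"
proof -
  let ?f = "\<lambda>n x. ennreal (trunc z (real (Suc n)) x)"
  have "liminf (\<lambda>n. ?f n x) = ennreal ((norm (x - z))\<^sup>2)" for x
    by (intro lim_imp_Liminf tendsto_ennrealI trunc_tendsto) simp
  then have "(\<integral>\<^sup>+ x. ennreal ((norm (x - z))\<^sup>2) \<partial>\<rho> t) = (\<integral>\<^sup>+ x. liminf (\<lambda>n. ?f n x) \<partial>\<rho> t)"
    by simp
  also have "\<dots> \<le> liminf (\<lambda>n. \<integral>\<^sup>+ x. ?f n x \<partial>\<rho> t)"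
    by (intro nn_integral_liminf measurable_rho t measurable_compose[OF _ measurable_ennreal]
        borel_measurable_continuous_onI continuous_trunc)
  also have "\<dots> \<le> liminf (\<lambda>n. ennreal (B n))"
  proof (intro Liminf_mono always_eventually allI)
    fix n
    have "(\<integral>\<^sup>+ x. ?f n x \<partial>\<rho> t) = ennreal (F (real (Suc n)) t)"
      by (intro nn_integral_eq_integral integrable_rho t bounded_trunc continuous_trunc always_eventually allI trunc_nonneg)
        auto
    with F show "(\<integral>\<^sup>+ x. ?f n x \<partial>\<rho> t) \<le> ennreal (B n)" by (simp add: ennreal_leI)
  qed
  also have "\<dots> = ennreal b"
    by (intro lim_imp_Liminf tendsto_ennrealI B) simp
  finally show ?thesis .
qed

text \<open>The remainder is dominated by $|x - z|^2$, which has a finite integral at every time since the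
  truncated moments do not exceed \<open>M0\<close>.\<close>

lemma E_tendsto:
  assumes t: "0 \<le> t"
  shows "(\<lambda>n. E (real (Suc n)) t) \<longlonglongrightarrow> 0"
proof -
  have "(\<integral>\<^sup>+ x. ennreal ((norm (x - z))\<^sup>2) \<partial>\<rho> t) \<le> ennreal M0"
    using t F_le_M0 by (intro second_moment_le[of t "\<lambda>_. M0"]) auto
  then have "integrable (\<rho> t) (\<lambda>x. (norm (x - z))\<^sup>2)"
    using t by (intro integrableI_bounded measurable_rho) (auto simp: le_less_trans)
  moreover have "norm (remainder z (real (Suc n)) x) \<le> (norm (x - z))\<^sup>2" for n x
    using remainder_bounds[of "real (Suc n)" z x] slope_bounds(2)[of "real (Suc n)" z x] by simp
  ultimately have "(\<lambda>n. E (real (Suc n)) t) \<longlonglongrightarrow> (\<integral>x. 0 \<partial>\<rho> t)"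
    using t
    by (intro integral_dominated_convergence[where w = "\<lambda>x. (norm (x - z))\<^sup>2"] measurable_rho
        borel_measurable_continuous_onI continuous_remainder always_eventually allI remainder_tendsto)
      auto
  then show ?thesis by simp
qed

text \<open>The function \<open>?U\<close> in the proof, $e^{ct} F_r(t) - c \int_0^t e^{cs} E_r(s)\,ds$, has a derivative that
  is not positive. Differentiating the integral requires that $E_r$ is continuous in time, which is
  narrow continuity applied to \<open>remainder\<close>.\<close>

lemma F_gronwall:
  assumes r: "0 < r" and T: "0 < T"
  shows "F r T \<le> exp (- c * T) * (M0 + c * integral {0..T} (\<lambda>s. exp (c * s) * E r s))"
proof -
  let ?G = "\<lambda>t. integral {0..t} (\<lambda>s. exp (c * s) * E r s)"
  let ?U = "\<lambda>t. exp (c * t) * F r t - c * ?G t"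
  have cE: "continuous_on {0..T} (\<lambda>s. exp (c * s) * E r s)"
    by (intro continuous_intros continuous_on_subset[OF E_continuous[OF r]]) auto
  have "?U T \<le> ?U 0"
  proof (rule DERIV_nonpos_imp_decreasing_open[where f = ?U, OF less_imp_le[OF T]])
    have "continuous_on {0..T} ?G"
      by (intro indefinite_integral_continuous_1 integrable_continuous_interval cE)
    then show "continuous_on {0..T} ?U"
      by (intro continuous_intros continuous_on_subset[OF F_continuous[OF r]]) auto
    fix t assume t: "0 < t" "t < T"
    obtain d where d: "(F r has_real_derivative d) (at t)" "d \<le> - c * (F r t - E r t)"
      using F_derivative[OF r t(1)] by blast
    have "(?G has_real_derivative exp (c * t) * E r t) (at t)"
      using integral_has_real_derivative[OF cE, of t] t by (simp add: at_within_Icc_at)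
    with d(1) have "(?U has_real_derivative exp (c * t) * (d + c * (F r t - E r t))) (at t)"
      by (auto intro!: derivative_eq_intros simp: algebra_simps)
    moreover have "exp (c * t) * (d + c * (F r t - E r t)) \<le> 0"
      using d(2) by (intro mult_nonneg_nonpos) auto
    ultimately show "\<exists>y. (?U has_real_derivative y) (at t) \<and> y \<le> 0" by blast
  qed
  also have "\<dots> \<le> M0" using F_initial[OF r] by simp
  finally have "exp (- c * T) * (exp (c * T) * F r T) \<le> exp (- c * T) * (M0 + c * ?G T)"
    by (intro mult_left_mono) auto
  then show ?thesis by (simp flip: mult.assoc exp_add)
qed

theorem second_moment_decay:
  assumes T: "0 < T"
  shows "(\<integral>\<^sup>+ x. ennreal ((norm (x - z))\<^sup>2) \<partial>\<rho> T) \<le> ennreal (exp (- c * T) * M0)"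
proof (rule second_moment_le)
  let ?I = "\<lambda>n. integral {0..T} (\<lambda>s. exp (c * s) * E (real (Suc n)) s)"
  show "F (real (Suc n)) T \<le> exp (- c * T) * (M0 + c * ?I n)" for n
    by (rule F_gronwall) (use T in auto)
  have "?I \<longlonglongrightarrow> integral {0..T} (\<lambda>s. 0)"
  proof (rule dominated_convergence(2))
    show "(\<lambda>s. exp (c * s) * E (real (Suc n)) s) integrable_on {0..T}" for n
      by (intro integrable_continuous_interval continuous_intros continuous_on_subset[OF E_continuous]) auto
    show "(\<lambda>s. exp (c * T) * M0) integrable_on {0..T}" by (rule integrable_const_ivl)
    show "norm (exp (c * s) * E (real (Suc n)) s) \<le> exp (c * T) * M0" if "s \<in> {0..T}" for n s
    proof -
      have "0 \<le> E (real (Suc n)) s" "E (real (Suc n)) s \<le> M0"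
        using E_bounds[of "real (Suc n)" s] F_le_M0[of "real (Suc n)" s] that by auto
      then show ?thesis
        using that c_pos by (auto simp: abs_mult intro!: mult_mono)
    qed
    show "(\<lambda>n. exp (c * s) * E (real (Suc n)) s) \<longlonglongrightarrow> 0" if "s \<in> {0..T}" for s
      using tendsto_mult[OF tendsto_const E_tendsto, of s "exp (c * s)"] that by simp
  qed
  then have "(\<lambda>n. exp (- c * T) * (M0 + c * ?I n)) \<longlonglongrightarrow> exp (- c * T) * (M0 + c * 0)"
    by (intro tendsto_intros) simp
  then show "(\<lambda>n. exp (- c * T) * (M0 + c * ?I n)) \<longlonglongrightarrow> exp (- c * T) * M0" by simp
qed (use T in simp)

end

section \<open>Convergence in the Wasserstein distance\<close>

lemma ennreal_sqrt_mono:
  assumes "a \<le> b"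
  shows "ennreal_sqrt a \<le> ennreal_sqrt b"
proof (cases "b = \<infinity>")
  case False
  then have "b < \<infinity>" by (simp add: less_top)
  moreover from this assms have "a \<noteq> \<infinity>" by auto
  ultimately show ?thesis
    using enn2real_mono[OF assms] by (simp add: ennreal_sqrt_def ennreal_leI)
qed (simp add: ennreal_sqrt_def)

lemma ennreal_sqrt_ennreal: "0 \<le> x \<Longrightarrow> ennreal_sqrt (ennreal x) = ennreal (sqrt x)"
  by (simp add: ennreal_sqrt_def)

text \<open>The product of \<open>\<nu>\<close> with the Dirac measure is a coupling; it is the image of \<open>\<nu>\<close> under
  $x \mapsto (x, z)$.\<close>

lemma W2_dirac_le:
  fixes z :: "'a::{metric_space, second_countable_topology}"
  assumes "borel_prob \<nu>"
  shows "W2 \<nu> (return borel z) \<le> ennreal_sqrt (\<integral>\<^sup>+ x. ennreal ((dist x z)\<^sup>2) \<partial>\<nu>)"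
proof -
  interpret prob_space \<nu> using assms by (simp add: borel_prob_def)
  have sets: "sets \<nu> = sets borel" using assms by (simp add: borel_prob_def)
  let ?\<gamma> = "distr \<nu> (borel \<Otimes>\<^sub>M borel) (\<lambda>x. (x, z))"
  have m: "(\<lambda>x. (x, z)) \<in> \<nu> \<rightarrow>\<^sub>M borel \<Otimes>\<^sub>M borel"
    using sets by (auto intro!: measurable_Pair measurable_ident_sets)
  have "distr \<nu> borel (\<lambda>x. z) = return borel z"
    by (rule measure_eqI) (auto simp: emeasure_distr emeasure_space_1 indicator_def)
  moreover have "distr \<nu> borel (\<lambda>x. x) = \<nu>" using sets by (simp add: distr_id2)
  ultimately have "?\<gamma> \<in> couplings \<nu> (return borel z)"
    using m by (auto simp: couplings_def distr_distr comp_def prob_space_distr)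
  then have "(INF \<gamma>\<in>couplings \<nu> (return borel z). \<integral>\<^sup>+ w. ennreal ((dist (fst w) (snd w))\<^sup>2) \<partial>\<gamma>)
      \<le> (\<integral>\<^sup>+ w. ennreal ((dist (fst w) (snd w))\<^sup>2) \<partial>?\<gamma>)" by (rule INF_lower)
  also have "\<dots> = (\<integral>\<^sup>+ x. ennreal ((dist x z)\<^sup>2) \<partial>\<nu>)"
    by (subst nn_integral_distr[OF m]) simp_all
  finally have "(INF \<gamma>\<in>couplings \<nu> (return borel z). \<integral>\<^sup>+ w. ennreal ((dist (fst w) (snd w))\<^sup>2) \<partial>\<gamma>)
      \<le> (\<integral>\<^sup>+ x. ennreal ((dist x z)\<^sup>2) \<partial>\<nu>)" .
  then show ?thesis unfolding W2_def by (rule ennreal_sqrt_mono)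
qed

theorem theorem2p5:
  fixes V :: "real^'n \<Rightarrow> real" and \<kappa> \<mu> L :: real
  assumes "\<kappa> > 0"
    and "\<forall>x. V x \<ge> 0"
    and "Ck 2 V"
    and "0 < \<mu>" and "\<mu> \<le> L"
    and "\<forall>x. \<mu> *\<^sub>R mat 1 \<preceq>\<^sub>L hessian V x \<and> hessian V x \<preceq>\<^sub>L L *\<^sub>R mat 1"
  shows "\<exists>C1>0. \<forall>\<sigma>::real. \<sigma> \<ge> 0 \<longrightarrow>
           (\<sigma> > 0 \<longrightarrow> Ck 3 V \<and>
              bdd_above (range (\<lambda>x. norm (gradient V x) * norm (third_derivative V x)))) \<longrightarrow>
           \<sigma> < C1 \<longrightarrow>
           (\<forall>\<rho>. FP_weak_solution \<sigma> (prox \<kappa> V) \<rho> \<and> energy (prox \<kappa> V) (\<rho> 0) < \<infinity> \<longrightarrow>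
              ((\<lambda>t. W2 (\<rho> t) (return borel (ARG_MIN V x. True))) \<longlongrightarrow> 0) at_top)"
proof -
  interpret strongly_convex V \<mu>
  proof
    show "V differentiable (at x)" for x using \<open>Ck 2 V\<close> by (simp add: numeral_2_eq_2)
    show "\<mu> * (norm (x - y))\<^sup>2 \<le> (gradient V x - gradient V y) \<bullet> (x - y)" for x y
      using assms by (intro gradient_strongly_monotone) auto
  qed fact
  let ?p = "prox \<kappa> V" and ?z = "ARG_MIN V x. True" and ?d = "real CARD('n)"
  have nonneg: "0 \<le> V x" for x using assms(2) by blast
  (* the contraction factor of the proximal map *)
  define \<theta> where "\<theta> = 1 / (1 + \<kappa>\<^sup>2 * \<mu>)"
  have pos: "0 < \<kappa>\<^sup>2 * \<mu>" using assms by simp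
  have \<theta>: "0 < \<theta>" "\<theta> < 1" using pos by (auto simp: \<theta>_def add_pos_pos)
  have contr: "norm (?p x - ?z) \<le> \<theta> * norm (x - ?z)" for x
    using prox_contraction[OF assms(1) nonneg, of x ?z] pos
    by (simp add: prox_minimizer[OF assms(1) nonneg] \<theta>_def field_simps)
  have upper: "norm (x - ?p x) \<le> 2 * norm (x - ?z)" for x
  proof -
    have "norm (x - ?p x) \<le> norm (x - ?z) + norm (?p x - ?z)"
      using norm_triangle_ineq4[of "x - ?z" "?p x - ?z"] by simp
    also have "\<theta> * norm (x - ?z) \<le> 1 * norm (x - ?z)" using \<theta> by (intro mult_right_mono) auto
    then have "norm (x - ?z) + norm (?p x - ?z) \<le> 2 * norm (x - ?z)" using contr[of x] by simp
    finally show ?thesis .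
  qed
  have lower: "(1 - \<theta>) * norm (x - ?z) \<le> norm (x - ?p x)" for x
    using norm_triangle_ineq[of "x - ?p x" "?p x - ?z"] contr[of x] by (simp add: algebra_simps)
  have drift: "(1 - \<theta>) * (norm (x - ?z))\<^sup>2 \<le> (x - ?z) \<bullet> (x - ?p x)" for x
  proof -
    have "(x - ?z) \<bullet> (?p x - ?z) \<le> norm (x - ?z) * (\<theta> * norm (x - ?z))"
      using norm_cauchy_schwarz[of "x - ?z" "?p x - ?z"] mult_left_mono[OF contr[of x] norm_ge_zero[of "x - ?z"]]
      by linarith
    moreover have "(x - ?z) \<bullet> (x - ?p x) = (norm (x - ?z))\<^sup>2 - (x - ?z) \<bullet> (?p x - ?z)"
      unfolding power2_norm_eq_inner inner_diff_right[symmetric] by simp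
    ultimately show ?thesis by (simp add: power2_eq_square algebra_simps)
  qed
  (* below this threshold the noise, at most 4 d \<sigma>^2 |x - z|^2 since |b| \<le> 2 |x - z|,
     consumes at most half of the dissipation 2 (1 - \<theta>) |x - z|^2 that the drift provides *)
  show ?thesis
  proof (intro exI[of _ "sqrt ((1 - \<theta>) / (4 * ?d))"] conjI allI impI)
    show "0 < sqrt ((1 - \<theta>) / (4 * ?d))" using \<theta> by simp
    fix \<sigma> :: real and \<rho>
    assume \<sigma>: "0 \<le> \<sigma>" "\<sigma> < sqrt ((1 - \<theta>) / (4 * ?d))"
      and sol: "FP_weak_solution \<sigma> ?p \<rho> \<and> energy ?p (\<rho> 0) < \<infinity>"
    have "\<sigma>\<^sup>2 \<le> (sqrt ((1 - \<theta>) / (4 * ?d)))\<^sup>2" using \<sigma> by (intro power_mono) auto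
    also have "\<dots> = (1 - \<theta>) / (4 * ?d)" using \<theta> by simp
    finally have \<sigma>d: "\<sigma>\<^sup>2 * ?d * 4 \<le> 1 - \<theta>" by (simp add: field_simps)
    interpret dissipative_FP \<sigma> "1 - \<theta>" ?p ?z \<rho>
    proof
      show "FP_weak_solution \<sigma> ?p \<rho>" using sol by simp
      show "continuous_on UNIV ?p" by (rule continuous_prox[OF assms(1) nonneg])
      show "0 < 1 - \<theta>" using \<theta> by simp
      show "\<sigma>\<^sup>2 * ?d * (norm (x - ?p x))\<^sup>2 - 2 * ((x - ?z) \<bullet> (x - ?p x))
          \<le> - (1 - \<theta>) * (norm (x - ?z))\<^sup>2" for x
      proof -
        have "(norm (x - ?p x))\<^sup>2 \<le> (2 * norm (x - ?z))\<^sup>2" by (intro power_mono upper) simp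
        then have "\<sigma>\<^sup>2 * ?d * (norm (x - ?p x))\<^sup>2 \<le> \<sigma>\<^sup>2 * ?d * (4 * (norm (x - ?z))\<^sup>2)"
          by (intro mult_left_mono) (auto simp: power_mult_distrib)
        also have "\<dots> \<le> (1 - \<theta>) * (norm (x - ?z))\<^sup>2"
          using mult_right_mono[OF \<sigma>d, of "(norm (x - ?z))\<^sup>2"] by (simp add: mult.assoc)
        finally show ?thesis using drift[of x] by (simp add: algebra_simps)
      qed
      have r0: "sets (\<rho> 0) = sets borel" using sol by (auto simp: FP_weak_solution_def borel_prob_def)
      have meas: "(\<lambda>x. ennreal ((norm (x - ?p x))\<^sup>2)) \<in> borel_measurable (\<rho> 0)"
        by (subst measurable_cong_sets[OF r0 refl])
          (intro measurable_compose[OF _ measurable_ennreal] borel_measurable_continuous_onI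
            continuous_intros continuous_prox[OF assms(1) nonneg])
      have "(\<integral>\<^sup>+ x. ennreal ((norm (x - ?z))\<^sup>2) \<partial>\<rho> 0)
          \<le> (\<integral>\<^sup>+ x. ennreal (1 / (1 - \<theta>)\<^sup>2) * ennreal ((norm (x - ?p x))\<^sup>2) \<partial>\<rho> 0)"
      proof (rule nn_integral_mono)
        fix x
        have "((1 - \<theta>) * norm (x - ?z))\<^sup>2 \<le> (norm (x - ?p x))\<^sup>2"
          using \<theta> by (intro power_mono lower) auto
        then have "(1 - \<theta>)\<^sup>2 * (norm (x - ?z))\<^sup>2 \<le> (norm (x - ?p x))\<^sup>2"
          by (simp only: power_mult_distrib)
        then have "(norm (x - ?z))\<^sup>2 \<le> 1 / (1 - \<theta>)\<^sup>2 * (norm (x - ?p x))\<^sup>2"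
          using \<theta> by (simp add: pos_le_divide_eq mult.commute)
        then show "ennreal ((norm (x - ?z))\<^sup>2) \<le> ennreal (1 / (1 - \<theta>)\<^sup>2) * ennreal ((norm (x - ?p x))\<^sup>2)"
          by (simp add: ennreal_leI flip: ennreal_mult)
      qed
      also have "\<dots> = ennreal (1 / (1 - \<theta>)\<^sup>2) * (\<integral>\<^sup>+ x. ennreal ((norm (x - ?p x))\<^sup>2) \<partial>\<rho> 0)"
        by (rule nn_integral_cmult[OF meas])
      also have "\<dots> < \<infinity>"
        using sol by (auto simp: energy_def ennreal_mult_less_top ennreal_mult_eq_top_iff less_top)
      finally show "(\<integral>\<^sup>+ x. ennreal ((norm (x - ?z))\<^sup>2) \<partial>\<rho> 0) < \<infinity>" .
    qed
    let ?B = "\<lambda>t. sqrt (exp (- (1 - \<theta>) * t) * (\<integral>x. (norm (x - ?z))\<^sup>2 \<partial>\<rho> 0))"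
    have bound: "W2 (\<rho> t) (return borel ?z) \<le> ennreal (?B t)" if "0 < t" for t
    proof -
      have "W2 (\<rho> t) (return borel ?z) \<le> ennreal_sqrt (\<integral>\<^sup>+ x. ennreal ((dist x ?z)\<^sup>2) \<partial>\<rho> t)"
        using rho[of t] that by (intro W2_dirac_le) (auto simp: borel_prob_def)
      also have "\<dots> \<le> ennreal_sqrt (ennreal (exp (- (1 - \<theta>) * t) * (\<integral>x. (norm (x - ?z))\<^sup>2 \<partial>\<rho> 0)))"
        using second_moment_decay[OF that] by (intro ennreal_sqrt_mono) (simp add: dist_norm)
      also have "\<dots> = ennreal (?B t)" by (rule ennreal_sqrt_ennreal) simp
      finally show ?thesis .
    qed
    have "((\<lambda>t. exp (- (1 - \<theta>) * t)) \<longlongrightarrow> 0) at_top"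
      using \<theta> by (intro filterlim_compose[OF exp_at_bot] filterlim_tendsto_neg_mult_at_bot[OF tendsto_const _ filterlim_ident]) auto
    from tendsto_real_sqrt[OF tendsto_mult[OF this tendsto_const]]
    have "(?B \<longlongrightarrow> 0) at_top" by simp
    then have "((\<lambda>t. ennreal (?B t)) \<longlongrightarrow> 0) at_top"
      using tendsto_ennrealI[of ?B 0] by simp
    moreover have "\<forall>\<^sub>F t in at_top. W2 (\<rho> t) (return borel ?z) \<le> ennreal (?B t)"
      using eventually_gt_at_top[of 0] by (rule eventually_mono) (rule bound)
    ultimately show "((\<lambda>t. W2 (\<rho> t) (return borel ?z)) \<longlongrightarrow> 0) at_top"
      using tendsto_sandwich[OF _ _ tendsto_const, of "0::ennreal"] by (simp add: always_eventually)
  qed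
qed

end
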